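(* Let $k\ge 2$ and $\alpha>0$. For every time $t\ge 0$ and every realization of the vectors $e_t,d_t\in\mathbb{R}^k$ (eligibility trace and feature difference, as defined in the context), let $X_t=e_td_t^\top$, $Q_t=(I+\alpha e_te_t^\top)^{-1}$ and $\beta_t=1-\frac{\alpha\|e_t\|^2}{1+\alpha\|e_t\|^2}$. Then, eigenvalues being counted with multiplicity: (1) The matrix $(I-\alpha X_t)(I-\alpha X_t)^\top$ has $k-2$ eigenvalues equal to $1$, and 2 eigenvalues that are given by $$\lambda^{+},\lambda^{-}=1+\frac{\alpha^2\|e_t\|^2\|d_t\|^2-2\alpha e_t^\top d_t\pm\alpha\|e_t\|\|d_t\|\sqrt{\alpha^2\|e_t\|^2\|d_t\|^2+4-4\alpha e_t^\top d_t}}{2}.$$ (2) The matrix $(I-\alpha Q_tX_t)(I-\alpha Q_tX_t)^\top$ has $k-2$ eigenvalues equal to $1$, and 2 eigenvalues that are given by $$\lambda^{\mathrm{im},+},\lambda^{\mathrm{im},-}=1+\frac{\alpha^2\beta_t^2\|e_t\|^2\|d_t\|^2-2\alpha\beta_t e_t^\top d_t\pm\alpha\beta_t\|e_t\|\|d_t\|\sqrt{\alpha^2\beta_t^2\|e_t\|^2\|d_t\|^2+4-4\alpha\beta_t e_t^\top d_t}}{2}.$$ (3) Furthermore, $\|I-\alpha X_t\|_2=\max\{\lambda^+,1\}$ and $\|I-\alpha Q_tX_t\|_2=\max\{\lambda^{\mathrm{im},+},1\}$.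
   Context: Consider a discrete-time Markov chain $x_0,x_1,\dots$ on a finite state space $X$, ergodic and uni-chain, with a feature map $\phi:X\to\mathbb{R}^k$, a discount factor $\gamma\in(0,1)$ and a trace parameter $\lambda\in[0,1]$. Write $\phi_t=\phi(x_t)$. The eligibility trace $e_t\in\mathbb{R}^k$ satisfies $e_t=\gamma\lambda e_{t-1}+\phi_t$ for $t\ge 0$, started from some initial vector $e_{-1}\in\mathbb{R}^k$, and $d_t=\phi_t-\gamma\phi_{t+1}\in\mathbb{R}^k$. The step-size $\alpha>0$ is constant. With zero rewards, the standard TD($\lambda$) iteration is $w_{t+1}=(I-\alpha X_t)w_t$ and the implicit TD($\lambda$) iteration is $w^{\mathrm{im}}_{t+1}=(I-\alpha Q_tX_t)w^{\mathrm{im}}_t$. Here $I$ is the $k\times k$ identity matrix, $\|\cdot\|$ is the Euclidean norm of vectors, and $\|\cdot\|_2$ is the spectral norm of matrices. In each pair of eigenvalues, the superscript $+$ corresponds to the sign $+$ in front of the square root and the superscript $-$ to the sign $-$. The trace parameter $\lambda$ is unrelated to the eigenvalues $\lambda^{+},\lambda^{-}$.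
   Formalization: In part (3) the spectral norms are squared: the square of each norm equals max{λ⁺,1}, respectively max{λ^{im,+},1}; the unsquared identity fails, e.g. for α=1, e_t=d_t, ‖e_t‖²=4 (norm 3, λ⁺=9). *)

theory Defs
  imports "HOL-Analysis.Analysis" "HOL-Computational_Algebra.Computational_Algebra"
begin

text \<open>
  The recursion for the trace starts at time -1, so the value at time 0 is already one step
  away from the initial vector \<open>e_init\<close>.
\<close>

primrec elig_trace ::
  "real \<Rightarrow> real \<Rightarrow> ('s \<Rightarrow> real ^ 'k) \<Rightarrow> real ^ 'k \<Rightarrow> (nat \<Rightarrow> 's) \<Rightarrow> nat \<Rightarrow> real ^ 'k" where
  "elig_trace \<gamma> lam \<phi> e_init x 0 = (\<gamma> * lam) *\<^sub>R e_init + \<phi> (x 0)"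
| "elig_trace \<gamma> lam \<phi> e_init x (Suc t) = (\<gamma> * lam) *\<^sub>R elig_trace \<gamma> lam \<phi> e_init x t + \<phi> (x (Suc t))"

definition feature_diff ::
  "real \<Rightarrow> ('s \<Rightarrow> real ^ 'k) \<Rightarrow> (nat \<Rightarrow> 's) \<Rightarrow> nat \<Rightarrow> real ^ 'k" where
  "feature_diff \<gamma> \<phi> x t = \<phi> (x t) - \<gamma> *\<^sub>R \<phi> (x (Suc t))"

text \<open>
  The type constraints matter: \<^const>\<open>columnvector\<close> and \<^const>\<open>rowvector\<close> leave the inner
  dimension of the product open.
\<close>

definition outer :: "real ^ 'k \<Rightarrow> real ^ 'k \<Rightarrow> real ^ 'k ^ 'k" where
  "outer u v = (columnvector u :: real ^ 1 ^ 'k) ** (rowvector v :: real ^ 'k ^ 1)"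

definition charpoly :: "real ^ 'k ^ 'k \<Rightarrow> real poly" where
  "charpoly A = det (mat [:0, 1:] - (\<chi> i j. [:A $ i $ j:]))"

text \<open>
  Only the real eigenvalues are listed, with their algebraic multiplicities; if the multiset has
  \<open>CARD('k)\<close> elements, there are no others.
\<close>

definition eigenvalues :: "real ^ 'k ^ 'k \<Rightarrow> real multiset" where
  "eigenvalues A = proots (charpoly A)"

definition spectral_norm :: "real ^ 'k ^ 'k \<Rightarrow> real" where
  "spectral_norm A = onorm (\<lambda>v. A *v v)"

definition td_matrix :: "real \<Rightarrow> real ^ 'k \<Rightarrow> real ^ 'k \<Rightarrow> real ^ 'k ^ 'k" where
  "td_matrix \<alpha> e d = mat 1 - \<alpha> *\<^sub>R outer e d"

definition im_precond :: "real \<Rightarrow> real ^ 'k \<Rightarrow> real ^ 'k ^ 'k" where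
  "im_precond \<alpha> e = matrix_inv (mat 1 + \<alpha> *\<^sub>R outer e e)"

definition im_td_matrix :: "real \<Rightarrow> real ^ 'k \<Rightarrow> real ^ 'k \<Rightarrow> real ^ 'k ^ 'k" where
  "im_td_matrix \<alpha> e d = mat 1 - \<alpha> *\<^sub>R (im_precond \<alpha> e ** outer e d)"

definition im_factor :: "real \<Rightarrow> real ^ 'k \<Rightarrow> real" where
  "im_factor \<alpha> e = 1 - \<alpha> * (norm e)\<^sup>2 / (1 + \<alpha> * (norm e)\<^sup>2)"

text \<open>
  The following numbers are eigenvalues of \<open>A A\<^sup>T\<close>, where \<open>A\<close> is the matrix of one iteration, so
  they are squares of singular values of \<open>A\<close>. Hence it is the square of the spectral norm of \<open>A\<close>
  that equals their maximum. The unsquared identity is false: for \<open>d = e\<close> and \<open>\<alpha> \<parallel>e\<parallel>\<^sup>2 = 4\<close> the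
  spectral norm of \<open>I - \<alpha> e e\<^sup>T\<close> is 3, while the largest eigenvalue of \<open>A A\<^sup>T\<close> is 9.
\<close>

definition eig_plus :: "real \<Rightarrow> real ^ 'k \<Rightarrow> real ^ 'k \<Rightarrow> real" where
  "eig_plus \<alpha> e d =
     1 + (\<alpha>\<^sup>2 * (norm e)\<^sup>2 * (norm d)\<^sup>2 - 2 * \<alpha> * (e \<bullet> d)
          + \<alpha> * norm e * norm d *
            sqrt (\<alpha>\<^sup>2 * (norm e)\<^sup>2 * (norm d)\<^sup>2 + 4 - 4 * \<alpha> * (e \<bullet> d))) / 2"

definition eig_minus :: "real \<Rightarrow> real ^ 'k \<Rightarrow> real ^ 'k \<Rightarrow> real" where
  "eig_minus \<alpha> e d =
     1 + (\<alpha>\<^sup>2 * (norm e)\<^sup>2 * (norm d)\<^sup>2 - 2 * \<alpha> * (e \<bullet> d)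
          - \<alpha> * norm e * norm d *
            sqrt (\<alpha>\<^sup>2 * (norm e)\<^sup>2 * (norm d)\<^sup>2 + 4 - 4 * \<alpha> * (e \<bullet> d))) / 2"

definition im_eig_plus :: "real \<Rightarrow> real ^ 'k \<Rightarrow> real ^ 'k \<Rightarrow> real" where
  "im_eig_plus \<alpha> e d =
     1 + (\<alpha>\<^sup>2 * (im_factor \<alpha> e)\<^sup>2 * (norm e)\<^sup>2 * (norm d)\<^sup>2 - 2 * \<alpha> * im_factor \<alpha> e * (e \<bullet> d)
          + \<alpha> * im_factor \<alpha> e * norm e * norm d *
            sqrt (\<alpha>\<^sup>2 * (im_factor \<alpha> e)\<^sup>2 * (norm e)\<^sup>2 * (norm d)\<^sup>2 + 4 - 4 * \<alpha> * im_factor \<alpha> e * (e \<bullet> d))) / 2"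

definition im_eig_minus :: "real \<Rightarrow> real ^ 'k \<Rightarrow> real ^ 'k \<Rightarrow> real" where
  "im_eig_minus \<alpha> e d =
     1 + (\<alpha>\<^sup>2 * (im_factor \<alpha> e)\<^sup>2 * (norm e)\<^sup>2 * (norm d)\<^sup>2 - 2 * \<alpha> * im_factor \<alpha> e * (e \<bullet> d)
          - \<alpha> * im_factor \<alpha> e * norm e * norm d *
            sqrt (\<alpha>\<^sup>2 * (im_factor \<alpha> e)\<^sup>2 * (norm e)\<^sup>2 * (norm d)\<^sup>2 + 4 - 4 * \<alpha> * im_factor \<alpha> e * (e \<bullet> d))) / 2"

end

theory Submission
  imports Defs
begin

text \<open>
  With \<open>A = I - \<alpha> e d\<^sup>T\<close>, the matrix \<open>A A\<^sup>T\<close> is a perturbation of the identity by two rank-one terms,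
  so the matrix determinant lemma, applied twice, gives \<open>det (x I - A A\<^sup>T)\<close> as \<open>(x - 1)\<close> to the
  power \<open>k - 2\<close> times a quadratic with roots \<open>\<lambda>\<^sup>+\<close> and \<open>\<lambda>\<^sup>-\<close>. By Cauchy--Schwarz
  \<open>(\<lambda>\<^sup>+ - 1) (\<lambda>\<^sup>- - 1) \<le> 0\<close>, hence \<open>\<lambda>\<^sup>- \<le> 1 \<le> \<lambda>\<^sup>+\<close>. The squared spectral norm is the largest
  eigenvalue of \<open>A A\<^sup>T\<close>, because a unit vector at which \<open>\<parallel>A\<^sup>T v\<parallel>\<close> is maximal is an eigenvector.
  Finally \<open>Q e = \<beta> e\<close>, so the implicit iteration is the standard one with step size \<open>\<alpha> \<beta>\<close>.
\<close>

section \<open>Rank-one matrices\<close>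

lemma outer_nth: "outer u v $ i $ j = u $ i * v $ j"
  by (simp add: outer_def columnvector_def rowvector_def matrix_matrix_mult_def)

lemma outer_mult_vec: "outer u v *v x = (v \<bullet> x) *\<^sub>R u"
  by (simp add: vec_eq_iff matrix_vector_mult_def outer_nth inner_vec_def sum_distrib_left
      sum_distrib_right mult_ac)

lemma transpose_outer: "transpose (outer u v) = outer v u"
  by (simp add: vec_eq_iff transpose_def outer_nth mult.commute)

lemma transpose_minus: "transpose (A - B) = transpose A - transpose (B :: 'a::ab_group_add^'n^'m)"
  by (simp add: vec_eq_iff transpose_def)

lemma outer_scaleR_left: "outer (c *\<^sub>R u) v = c *\<^sub>R outer u v"
  by (simp add: vec_eq_iff outer_nth)

lemma matrix_mult_outer: "A ** outer u v = outer (A *v u) v"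
  by (simp add: matrix_eq matrix_vector_mul_assoc[symmetric] outer_mult_vec
      matrix_vector_mult_scaleR)

section \<open>Determinants of rank-one and rank-two perturbations of the identity\<close>

lemma det_scaleR: "det (c *\<^sub>R A) = c ^ CARD('n) * det (A :: real^'n^'n)"
  using det_rows_mul[of "\<lambda>_. c" "\<lambda>i. A $ i"]
  by (simp add: scalar_mult_eq_scaleR vec_lambda_eta scaleR_vec_def)

lemma det_mat_1_plus_outer: "det (mat 1 + outer u v) = 1 + u \<bullet> v"
proof (cases "v = 0")
  case True
  then have "mat 1 + outer u v = mat 1" by (simp add: vec_eq_iff outer_nth)
  then show ?thesis using True by simp
next
  case False
  \<comment> \<open>Rotating \<open>v\<close> onto an axis leaves a matrix that differs from the identity in one column only.\<close>
  obtain Q and k :: 'a where Q: "orthogonal_matrix Q" "Q *v axis k 1 = v /\<^sub>R norm v"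
    using orthogonal_matrix_exists_basis[of "v /\<^sub>R norm v", OF _ that] False by simp
  define P where "P = transpose Q"
  have PQ: "P ** Q = mat 1" using Q(1) by (simp add: P_def orthogonal_matrix_def)
  have "P *v (v /\<^sub>R norm v) = axis k 1"
    by (simp add: Q(2)[symmetric] matrix_vector_mul_assoc PQ)
  then have "norm v *\<^sub>R axis k 1 = norm v *\<^sub>R (P *v (v /\<^sub>R norm v))" by simp
  then have Pv: "P *v v = norm v *\<^sub>R axis k 1"
    using False by (simp add: matrix_vector_mult_scaleR)
  have inner_P: "(P *v u) \<bullet> (P *v v) = u \<bullet> v"
    using Q(1) by (metis P_def dot_lmul_matrix matrix_vector_mul_assoc matrix_vector_mul_lid
        orthogonal_matrix_def vector_transpose_matrix transpose_transpose inner_commute)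
  have "det (mat 1 + outer u v) = det (P ** (mat 1 + outer u v) ** Q)"
    using PQ by (metis det_I det_mul mult.commute mult.left_commute mult_1)
  also have "P ** (mat 1 + outer u v) ** Q = mat 1 + outer (P *v u) (P *v v)"
    by (simp add: matrix_eq matrix_vector_mul_assoc[symmetric] matrix_vector_mult_add_rdistrib
        matrix_vector_right_distrib matrix_vector_mult_scaleR outer_mult_vec)
      (simp add: matrix_vector_mul_assoc PQ dot_lmul_matrix P_def PQ[unfolded P_def])
  \<comment> \<open>This is the shape of \<open>cramer_lemma\<close> over the identity matrix: the
    determinant is the \<open>k\<close>-th entry of the vector that fills column
    \<open>k\<close>.\<close>
  also have "\<dots> = (\<chi> i j. if j = k then (mat 1 *v (axis k 1 + norm v *\<^sub>R (P *v u))) $ i else mat 1 $ i $ j)"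
    unfolding matrix_vector_mul_lid by (auto simp: vec_eq_iff outer_nth Pv mat_def axis_def)
  also have "det \<dots> = 1 + (P *v u) \<bullet> (P *v v)"
    by (subst cramer_lemma) (simp add: Pv inner_axis)
  finally show ?thesis by (simp add: inner_P)
qed

text \<open>Pulling out the first perturbation as a factor leaves another rank-one perturbation, so
  the rank-one formula applies twice. The hypothesis makes that factor invertible.\<close>

lemma det_mat_1_plus_two_outer:
  assumes "1 + u \<bullet> v \<noteq> 0"
  shows "det (mat 1 + outer u v + outer w z) =
    (1 + u \<bullet> v) * (1 + w \<bullet> z) - (u \<bullet> z) * (w \<bullet> v)"
proof -
  \<comment> \<open>\<open>r\<close> is the preimage of \<open>w\<close> under the invertible matrix \<open>I + u v\<^sup>T\<close>.\<close>
  define c where "c = (w \<bullet> v) / (1 + u \<bullet> v)"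
  define r where "r = w - c *\<^sub>R u"
  have c: "c + c * (u \<bullet> v) = w \<bullet> v"
  proof -
    have "(1 + u \<bullet> v) * c = w \<bullet> v" using assms by (simp add: c_def)
    then show ?thesis by (simp add: algebra_simps)
  qed
  then have "v \<bullet> r = c"
    by (simp add: r_def inner_diff_right inner_commute[of v] algebra_simps)
  then have "(mat 1 + outer u v) *v r = w"
    by (simp add: matrix_vector_mult_add_rdistrib outer_mult_vec) (simp add: r_def)
  then have "mat 1 + outer u v + outer w z = (mat 1 + outer u v) ** (mat 1 + outer r z)"
    by (simp add: matrix_add_ldistrib matrix_mult_outer)
  then have "det (mat 1 + outer u v + outer w z) = (1 + u \<bullet> v) * (1 + r \<bullet> z)"
    by (simp add: det_mul det_mat_1_plus_outer)
  also have "\<dots> = (1 + u \<bullet> v) * (1 + w \<bullet> z) - (u \<bullet> z) * (w \<bullet> v)"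
    using c by (simp add: r_def inner_diff_left algebra_simps flip: c)
  finally show ?thesis .
qed

section \<open>Characteristic polynomials through their values\<close>

lemma poly_charpoly: "poly (charpoly A) x = det (mat x - A)"
proof -
  have "poly (charpoly A) x = (\<Sum>p\<in>{p. p permutes (UNIV :: 'a set)}. of_int (sign p) *
      (\<Prod>i\<in>UNIV. poly ((mat [:0, 1:] - (\<chi> i j. [:A $ i $ j:])) $ i $ p i) x))"
    by (simp add: charpoly_def det_def poly_sum poly_prod)
  also have "\<dots> = det (mat x - A)"
    unfolding det_def by (intro sum.cong prod.cong arg_cong2[of _ _ _ _ "(*)"]) (auto simp: mat_def)
  finally show ?thesis .
qed

text \<open>Allows characteristic polynomials to be compared away from the points where a division
  or a factorization breaks down.\<close>

lemma poly_eqI_cofinite: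
  fixes p q :: "'a :: {idom, ring_char_0} poly"
  assumes "finite S" "\<And>x. x \<notin> S \<Longrightarrow> poly p x = poly q x"
  shows "p = q"
proof (rule ccontr)
  assume "p \<noteq> q"
  then have "finite {x. poly (p - q) x = 0}" by (intro poly_roots_finite) simp
  moreover have "UNIV \<subseteq> S \<union> {x. poly (p - q) x = 0}" using assms(2) by auto
  ultimately show False using assms(1) infinite_UNIV_char_0
    by (metis finite_UnI finite_subset)
qed

section \<open>The spectrum for the standard iteration\<close>

lemma td_matrix_mult_transpose:
  "td_matrix \<alpha> e d ** transpose (td_matrix \<alpha> e d) =
   mat 1 + outer e ((\<alpha>\<^sup>2 * (norm d)\<^sup>2) *\<^sub>R e - \<alpha> *\<^sub>R d) + outer d (- \<alpha> *\<^sub>R e)"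
  \<comment> \<open>The terms in \<open>outer e d\<close> and \<open>outer e e\<close> share the
    left factor \<open>e\<close>, so two rank-one terms suffice.\<close>
  by (simp add: matrix_eq td_matrix_def transpose_minus transpose_scalar transpose_outer
      matrix_vector_mul_assoc[symmetric] matrix_vector_mult_diff_rdistrib
      matrix_vector_mult_add_rdistrib scaleR_matrix_vector_assoc[symmetric] outer_mult_vec
      matrix_vector_mult_diff_distrib inner_diff_left inner_diff_right algebra_simps
      power2_eq_square dot_square_norm)

text \<open>Cauchy-Schwarz bounds the expression below by the square of
  \<open>\<bar>\<alpha>\<bar> * norm e * norm d - 2\<close>.\<close>

lemma eig_discriminant_nonneg:
  "0 \<le> \<alpha>\<^sup>2 * (norm e)\<^sup>2 * (norm d)\<^sup>2 + 4 - 4 * \<alpha> * (e \<bullet> d)"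
proof -
  have "\<bar>\<alpha> * (e \<bullet> d)\<bar> \<le> \<bar>\<alpha>\<bar> * (norm e * norm d)"
    by (simp add: abs_mult Cauchy_Schwarz_ineq2 mult_left_mono)
  moreover have "0 \<le> (\<bar>\<alpha>\<bar> * norm e * norm d - 2)\<^sup>2" by simp
  ultimately show ?thesis by (simp add: power2_diff power_mult_distrib)
qed

lemma eig_sum:
  "eig_plus \<alpha> e d + eig_minus \<alpha> e d = 2 + \<alpha>\<^sup>2 * (norm e)\<^sup>2 * (norm d)\<^sup>2 - 2 * \<alpha> * (e \<bullet> d)"
  by (simp add: eig_plus_def eig_minus_def field_simps)

text \<open>A difference of squares in which the mixed terms cancel. Together with
  \<open>eig_sum\<close> it determines the quadratic with these two roots.\<close>

lemma eig_prod_shifted: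
  "(eig_plus \<alpha> e d - 1) * (eig_minus \<alpha> e d - 1) =
   \<alpha>\<^sup>2 * ((e \<bullet> d)\<^sup>2 - (norm e)\<^sup>2 * (norm d)\<^sup>2)"
proof -
  define r where "r = sqrt (\<alpha>\<^sup>2 * (norm e)\<^sup>2 * (norm d)\<^sup>2 + 4 - 4 * \<alpha> * (e \<bullet> d))"
  have "r\<^sup>2 = \<alpha>\<^sup>2 * (norm e)\<^sup>2 * (norm d)\<^sup>2 + 4 - 4 * \<alpha> * (e \<bullet> d)"
    unfolding r_def using eig_discriminant_nonneg by simp
  moreover have "(1 + (p + q) / 2 - 1) * (1 + (p - q) / 2 - 1) = (p\<^sup>2 - q\<^sup>2) / 4" for p q :: real
    by (simp add: power2_eq_square field_simps)
  ultimately show ?thesis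
    unfolding eig_plus_def eig_minus_def r_def[symmetric]
    by (simp add: power_mult_distrib) (simp add: power2_eq_square algebra_simps)
qed

lemma eig_plus_ge_1_minus_le_1:
  assumes "0 \<le> \<alpha>"
  shows "1 \<le> eig_plus \<alpha> e d" "eig_minus \<alpha> e d \<le> 1"
proof -
  \<comment> \<open>A nonpositive product only gives opposite signs; the sign of
    \<open>\<alpha>\<close> decides which root is the larger.\<close>
  have "eig_minus \<alpha> e d \<le> eig_plus \<alpha> e d"
    using assms eig_discriminant_nonneg[of \<alpha> e d] by (simp add: eig_plus_def eig_minus_def)
  moreover have "(eig_plus \<alpha> e d - 1) * (eig_minus \<alpha> e d - 1) \<le> 0"
    using Cauchy_Schwarz_ineq[of e d]
    by (simp add: eig_prod_shifted power2_norm_eq_inner mult_nonneg_nonpos)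
  ultimately show "1 \<le> eig_plus \<alpha> e d" "eig_minus \<alpha> e d \<le> 1"
    by (auto simp: mult_le_0_iff)
qed

lemma charpoly_td_matrix:
  fixes e d :: "real ^ 'k"
  assumes "CARD('k) \<ge> 2"
  shows "charpoly (td_matrix \<alpha> e d ** transpose (td_matrix \<alpha> e d)) =
    [:-1, 1:] ^ (CARD('k) - 2) * ([:- eig_plus \<alpha> e d, 1:] * [:- eig_minus \<alpha> e d, 1:])"
    (is "charpoly ?B = ?q")
proof (rule poly_eqI_cofinite)
  define a where "a = (\<alpha>\<^sup>2 * (norm d)\<^sup>2) *\<^sub>R e - \<alpha> *\<^sub>R d"
  define b where "b = - \<alpha> *\<^sub>R e"
  \<comment> \<open>At 1 the scaling by \<open>1 / y\<close> fails; at the other point the first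
    rank-one perturbation \<open>mat 1 + outer ?E a\<close> becomes singular.\<close>
  show "finite {1, 1 + e \<bullet> a}" by simp
  fix x assume x: "x \<notin> {1, 1 + e \<bullet> a}"
  define y where "y = x - 1"
  have y: "y \<noteq> 0" "y \<noteq> e \<bullet> a" using x by (auto simp: y_def)
  let ?E = "(- 1 / y) *\<^sub>R e" and ?D = "(- 1 / y) *\<^sub>R d"
  have B: "?B = mat 1 + outer e a + outer d b"
    by (simp only: td_matrix_mult_transpose a_def b_def)
  have "mat x - ?B = y *\<^sub>R (mat 1 + outer ?E a + outer ?D b)"
  proof -
    have "mat x = y *\<^sub>R mat 1 + (mat 1 :: real^'k^'k)"
      by (simp add: vec_eq_iff mat_def y_def)
    then show ?thesis
      unfolding B outer_scaleR_left using y(1)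
      by (simp add: scaleR_add_right scaleR_diff_right)
  qed
  then have "poly (charpoly ?B) x = y ^ CARD('k) * det (mat 1 + outer ?E a + outer ?D b)"
    by (simp add: poly_charpoly det_scaleR)
  also have "\<dots> = y ^ CARD('k) * ((1 - (e \<bullet> a) / y) * (1 - (d \<bullet> b) / y) - (e \<bullet> b) / y * ((d \<bullet> a) / y))"
    using y by (subst det_mat_1_plus_two_outer) (auto simp: field_simps)
  \<comment> \<open>Two of the \<open>CARD('k)\<close> factors \<open>y\<close> clear the two
    denominators.\<close>
  also have "\<dots> = y ^ (CARD('k) - 2) * ((y - e \<bullet> a) * (y - d \<bullet> b) - (e \<bullet> b) * (d \<bullet> a))"
    using assms y(1)
    by (subst le_add_diff_inverse[OF assms, symmetric], unfold power_add) (simp add: field_simps power2_eq_square)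
  \<comment> \<open>Vieta in the shifted variable \<open>y\<close>, whose roots are the claimed
    eigenvalues minus 1.\<close>
  also have "(y - e \<bullet> a) * (y - d \<bullet> b) - (e \<bullet> b) * (d \<bullet> a) =
      y\<^sup>2 - ((eig_plus \<alpha> e d + eig_minus \<alpha> e d) - 2) * y + (eig_plus \<alpha> e d - 1) * (eig_minus \<alpha> e d - 1)"
    unfolding eig_sum eig_prod_shifted a_def b_def power2_norm_eq_inner
    by (simp add: inner_diff_right inner_commute[of d e] algebra_simps power2_eq_square)
  also have "\<dots> = (x - eig_plus \<alpha> e d) * (x - eig_minus \<alpha> e d)"
    by (simp add: y_def algebra_simps power2_eq_square)
  finally show "poly (charpoly ?B) x = poly ?q x"
    by (simp add: y_def poly_power algebra_simps)
qed

lemma eigenvalues_td_matrix: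
  fixes e d :: "real ^ 'k"
  assumes "CARD('k) \<ge> 2"
  shows "eigenvalues (td_matrix \<alpha> e d ** transpose (td_matrix \<alpha> e d)) =
    replicate_mset (CARD('k) - 2) 1 + {#eig_plus \<alpha> e d, eig_minus \<alpha> e d#}"
  unfolding eigenvalues_def charpoly_td_matrix[OF assms]
  by (simp add: proots_mult proots_power del: mult_pCons_left mult_pCons_right)

section \<open>Eigenvectors and the spectral norm\<close>

lemma poly_charpoly_eq_0_iff:
  "poly (charpoly A) x = 0 \<longleftrightarrow> (\<exists>v. v \<noteq> 0 \<and> A *v v = x *\<^sub>R v)"
proof -
  have mat: "mat x *v v = x *\<^sub>R v" for v
    by (simp add: mat_def matrix_vector_mult_def vec_eq_iff if_distrib if_distribR cong: if_cong)
  have "poly (charpoly A) x = 0 \<longleftrightarrow> \<not> (\<exists>B. B ** (mat x - A) = mat 1)"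
    unfolding poly_charpoly by (metis invertible_det_nz invertible_left_inverse)
  then show ?thesis
    unfolding matrix_left_invertible_ker by (auto simp: matrix_vector_mult_diff_rdistrib mat)
qed

lemma norm_mult_vec_le: "norm (A *v v) \<le> spectral_norm A * norm v"
  unfolding spectral_norm_def by (rule onorm) simp

lemma spectral_norm_nonneg: "0 \<le> spectral_norm A"
  unfolding spectral_norm_def by (rule onorm_pos_le) simp

text \<open>No eigenvalue exceeds the spectral norm, so the polynomial does not vanish just beyond
  it. This matters because \<open>proots\<close> of the zero polynomial is empty by
  convention.\<close>

lemma charpoly_neq_0: "charpoly A \<noteq> 0"
proof -
  have "v = 0" if "A *v v = (spectral_norm A + 1) *\<^sub>R v" for v
    using norm_mult_vec_le[of A v] spectral_norm_nonneg[of A]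
    by (simp add: that ring_distribs del: scaleR_left_distrib)
  then have "poly (charpoly A) (spectral_norm A + 1) \<noteq> 0"
    unfolding poly_charpoly_eq_0_iff by blast
  then show ?thesis by auto
qed

lemma in_eigenvalues_iff:
  "x \<in># eigenvalues A \<longleftrightarrow> (\<exists>v. v \<noteq> 0 \<and> A *v v = x *\<^sub>R v)"
  by (simp add: eigenvalues_def charpoly_neq_0 poly_charpoly_eq_0_iff)

lemma inner_mult_vec_transpose: "x \<bullet> (A *v y) = (transpose A *v x) \<bullet> (y :: real^'n)"
  for A :: "real^'n^'n"
  by (simp add: dot_lmul_matrix)

text \<open>Moving the transpose across the inner product gives
  \<open>norm ?w * norm ?w = v \<bullet> (A *v ?w)\<close>; Cauchy-Schwarz and cancelling one factor
  \<open>norm ?w\<close> finish.\<close>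

lemma spectral_norm_transpose_le: "spectral_norm (transpose A) \<le> spectral_norm A"
  unfolding spectral_norm_def[of "transpose A"]
proof (rule onorm_le)
  fix v
  let ?w = "transpose A *v v"
  have "norm ?w * norm ?w = v \<bullet> (A *v ?w)"
    by (simp only: inner_mult_vec_transpose power2_norm_eq_inner[symmetric] power2_eq_square)
  also have "\<dots> \<le> norm v * (spectral_norm A * norm ?w)"
    by (meson norm_cauchy_schwarz norm_mult_vec_le mult_left_mono norm_ge_zero order_trans)
  finally have "norm ?w * norm ?w \<le> (spectral_norm A * norm v) * norm ?w" by (simp add: mult_ac)
  then show "norm ?w \<le> spectral_norm A * norm v"
    using spectral_norm_nonneg[of A]
    by (cases "norm ?w = 0") (simp, metis mult_right_le_imp_le norm_ge_zero less_eq_real_def)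
qed

lemma spectral_norm_transpose: "spectral_norm (transpose A) = spectral_norm A"
  using spectral_norm_transpose_le[of A] spectral_norm_transpose_le[of "transpose A"]
  by simp

text \<open>The unit sphere is compact, and homogeneity carries a maximum there to all
  vectors.\<close>

lemma spectral_norm_attained:
  obtains v where "norm v = 1" "norm (A *v v) = spectral_norm A"
proof -
  have "continuous_on (sphere 0 1) (\<lambda>v. norm (A *v v))"
    by (intro continuous_intros linear_continuous_on matrix_vector_mul_bounded_linear)
  moreover have "sphere 0 1 \<noteq> ({} :: (real^'a) set)" by simp
  ultimately obtain v where v: "norm v = 1" "\<And>w. norm w = 1 \<Longrightarrow> norm (A *v w) \<le> norm (A *v v)"
    using continuous_attains_sup[OF compact_sphere, of 0 1 "\<lambda>v. norm (A *v v)"] by auto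
  have "spectral_norm A \<le> norm (A *v v)"
    unfolding spectral_norm_def
  proof (rule onorm_le)
    fix w
    show "norm (A *v w) \<le> norm (A *v v) * norm w"
      using v(2)[of "w /\<^sub>R norm w"]
      by (cases "w = 0") (auto simp: matrix_vector_mult_scaleR field_simps)
  qed
  then show ?thesis using that[of v] v(1) norm_mult_vec_le[of A v] by simp
qed

lemma spectral_norm_power2_in_eigenvalues:
  "(spectral_norm A)\<^sup>2 \<in># eigenvalues (A ** transpose A)"
proof -
  define s where "s = spectral_norm A"
  obtain v where v: "norm v = 1" "norm (transpose A *v v) = s"
    using spectral_norm_attained[of "transpose A"] by (auto simp: spectral_norm_transpose s_def)
  let ?u = "A *v (transpose A *v v)"
  \<comment> \<open>Equality in Cauchy--Schwarz: \<open>v \<bullet> A A\<^sup>T v = s\<^sup>2\<close> while \<open>\<parallel>A A\<^sup>T v\<parallel> \<le> s\<^sup>2\<close> and \<open>\<parallel>v\<parallel> = 1\<close>.\<close>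
  have "norm ?u \<le> s * s"
    using norm_mult_vec_le[of A "transpose A *v v"] by (simp only: v s_def)
  then have "(norm ?u)\<^sup>2 \<le> (s * s)\<^sup>2" by (intro power_mono) auto
  moreover have "v \<bullet> ?u = s\<^sup>2"
    by (simp only: inner_mult_vec_transpose power2_norm_eq_inner[symmetric] v)
  moreover have "(norm (?u - s\<^sup>2 *\<^sub>R v))\<^sup>2 = (norm ?u)\<^sup>2 - 2 * s\<^sup>2 * (v \<bullet> ?u) + (s\<^sup>2)\<^sup>2 * (norm v)\<^sup>2"
    unfolding power2_norm_eq_inner
    by (simp add: inner_diff_left inner_diff_right inner_commute power2_eq_square algebra_simps)
  ultimately have "(norm (?u - s\<^sup>2 *\<^sub>R v))\<^sup>2 \<le> 0"
    by (simp add: v power2_eq_square)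
  then have "?u = s\<^sup>2 *\<^sub>R v" by simp
  moreover have "v \<noteq> 0" using v(1) by auto
  ultimately show ?thesis
    unfolding in_eigenvalues_iff matrix_vector_mul_assoc[symmetric] s_def by blast
qed

text \<open>Rayleigh quotient: an eigenvector \<open>v\<close> satisfies
  \<open>x * (norm v)\<^sup>2 = (norm (transpose A *v v))\<^sup>2\<close>.\<close>

lemma eigenvalues_le_spectral_norm_power2:
  assumes "x \<in># eigenvalues (A ** transpose A)"
  shows "x \<le> (spectral_norm A)\<^sup>2"
proof -
  obtain v where v: "v \<noteq> 0" "A *v (transpose A *v v) = x *\<^sub>R v"
    using assms unfolding in_eigenvalues_iff matrix_vector_mul_assoc[symmetric] by blast
  have "x * (norm v)\<^sup>2 = v \<bullet> (A *v (transpose A *v v))"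
    unfolding v(2) by (simp add: power2_norm_eq_inner)
  also have "\<dots> = (norm (transpose A *v v))\<^sup>2"
    by (simp only: inner_mult_vec_transpose power2_norm_eq_inner)
  also have "\<dots> \<le> (spectral_norm A * norm v)\<^sup>2"
    using norm_mult_vec_le[of "transpose A" v] by (intro power_mono) (simp_all add: spectral_norm_transpose)
  finally show ?thesis using v(1) by (simp add: power_mult_distrib)
qed

lemma spectral_norm_td_matrix:
  fixes e d :: "real ^ 'k"
  assumes "CARD('k) \<ge> 2" "0 \<le> \<alpha>"
  shows "(spectral_norm (td_matrix \<alpha> e d))\<^sup>2 = max (eig_plus \<alpha> e d) 1"
proof -
  have "(spectral_norm (td_matrix \<alpha> e d))\<^sup>2 \<in> {1, eig_plus \<alpha> e d, eig_minus \<alpha> e d}"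
    using spectral_norm_power2_in_eigenvalues[of "td_matrix \<alpha> e d"]
    by (auto simp: eigenvalues_td_matrix[OF assms(1)] split: if_splits)
  moreover have "eig_plus \<alpha> e d \<le> (spectral_norm (td_matrix \<alpha> e d))\<^sup>2"
    by (rule eigenvalues_le_spectral_norm_power2) (simp add: eigenvalues_td_matrix[OF assms(1)])
  \<comment> \<open>A listed value that dominates \<lambda>+ must equal it, since \<lambda>- \<le> 1
    \<le> \<lambda>+. This also covers dimension 2, where the list has no separate entry 1.\<close>
  ultimately show ?thesis
    using eig_plus_ge_1_minus_le_1[OF assms(2), of e d] by auto
qed

section \<open>Reduction of the implicit iteration to the standard one\<close>

lemma im_factor_eq: "0 \<le> \<alpha> \<Longrightarrow> im_factor \<alpha> e = 1 / (1 + \<alpha> * (norm e)\<^sup>2)"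
  by (simp add: im_factor_def field_simps add_nonneg_eq_0_iff)

text \<open>The trace is an eigenvector of the matrix being inverted, with eigenvalue
  \<open>1 + \<alpha> * (norm e)\<^sup>2\<close>.\<close>

lemma im_precond_mult_trace:
  assumes "0 \<le> \<alpha>"
  shows "im_precond \<alpha> e *v e = im_factor \<alpha> e *\<^sub>R e"
proof -
  let ?M = "mat 1 + \<alpha> *\<^sub>R outer e e" and ?c = "1 + \<alpha> * (norm e)\<^sup>2"
  have c: "0 < ?c" using assms by (simp add: add_pos_nonneg)
  have "det ?M = ?c"
    by (simp add: outer_scaleR_left[symmetric] det_mat_1_plus_outer power2_norm_eq_inner)
  \<comment> \<open>\<open>matrix_inv\<close> is a choice operator, so it is known to be an inverse
    only once one exists.\<close>
  then have "invertible ?M" using c by (simp add: invertible_det_nz)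
  then have inv: "im_precond \<alpha> e ** ?M = mat 1"
    unfolding invertible_def im_precond_def matrix_inv_def by (rule someI2_ex) blast
  have "?M *v e = ?c *\<^sub>R e"
    by (simp add: matrix_vector_mult_add_rdistrib scaleR_matrix_vector_assoc[symmetric]
        outer_mult_vec power2_norm_eq_inner scaleR_add_left)
  then have "?c *\<^sub>R (im_precond \<alpha> e *v e) = e"
    by (metis inv matrix_vector_mul_assoc matrix_vector_mul_lid matrix_vector_mult_scaleR)
  then show ?thesis
    using c im_factor_eq[OF assms, of e] by (simp add: eq_vector_fraction_iff)
qed

text \<open>The preconditioner acts only on the left factor of \<open>outer e d\<close>, where it
  rescales \<open>e\<close>.\<close>

lemma im_td_matrix_eq:
  "0 \<le> \<alpha> \<Longrightarrow> im_td_matrix \<alpha> e d = td_matrix (\<alpha> * im_factor \<alpha> e) e d"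
  by (simp add: im_td_matrix_def td_matrix_def matrix_mult_outer im_precond_mult_trace outer_scaleR_left)

lemma im_eig_eq:
  "im_eig_plus \<alpha> e d = eig_plus (\<alpha> * im_factor \<alpha> e) e d"
  "im_eig_minus \<alpha> e d = eig_minus (\<alpha> * im_factor \<alpha> e) e d"
  by (simp_all add: im_eig_plus_def im_eig_minus_def eig_plus_def eig_minus_def power_mult_distrib mult.assoc)

theorem lemma1:
  fixes x :: "nat \<Rightarrow> 's::finite"
    and \<phi> :: "'s \<Rightarrow> real ^ 'k"
    and e_init e d :: "real ^ 'k"
    and \<gamma> lam \<alpha> :: real
    and t :: nat
  assumes "CARD('k) \<ge> 2"
    and "\<alpha> > 0"
    and "0 < \<gamma>" and "\<gamma> < 1"
    and "0 \<le> lam" and "lam \<le> 1"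
    and "e = elig_trace \<gamma> lam \<phi> e_init x t"
    and "d = feature_diff \<gamma> \<phi> x t"
  shows "eigenvalues (td_matrix \<alpha> e d ** transpose (td_matrix \<alpha> e d)) =
           replicate_mset (CARD('k) - 2) 1 + {#eig_plus \<alpha> e d, eig_minus \<alpha> e d#} \<and>
         eigenvalues (im_td_matrix \<alpha> e d ** transpose (im_td_matrix \<alpha> e d)) =
           replicate_mset (CARD('k) - 2) 1 + {#im_eig_plus \<alpha> e d, im_eig_minus \<alpha> e d#} \<and>
         (spectral_norm (td_matrix \<alpha> e d))\<^sup>2 = max (eig_plus \<alpha> e d) 1 \<and>
         (spectral_norm (im_td_matrix \<alpha> e d))\<^sup>2 = max (im_eig_plus \<alpha> e d) 1"
proof -
  \<comment> \<open>The norm formula for the standard iteration requires a nonnegative step size,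
    here the effective one.\<close>
  have "0 \<le> \<alpha> * im_factor \<alpha> e"
    using assms(2) by (simp add: im_factor_eq)
  then show ?thesis
    using assms(1,2) by (simp only: im_td_matrix_eq im_eig_eq eigenvalues_td_matrix
        spectral_norm_td_matrix less_imp_le simp_thms)
qed

end
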